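(* Let $\overrightarrow{F}$ be the oriented graph on vertices $x,y_1,y_2,z$ with arcs $\overrightarrow{xy_1},\overrightarrow{xy_2},\overrightarrow{y_1z},\overrightarrow{y_2z}$. Then for all sufficiently large $n$, $\mathrm{ex}_{\mathrm{ori}}(n,\overrightarrow{F})=\lfloor n^2/4\rfloor+\lceil n/2\rceil$.
   Context: An oriented graph is a directed graph with no loops, no multiple arcs and no pair of opposite arcs. $\mathrm{ex}_{\mathrm{ori}}(n,\overrightarrow{F})$ is the largest number of arcs in an $n$-vertex oriented graph not containing $\overrightarrow{F}$ as a (not necessarily induced) subgraph. *)

theory Defs
  imports Complex_Main "Graph_Theory.Graph_Theory"
begin

locale oriented_digraph = digraph +
  assumes no_opposite_arcs: "u \<rightarrow>\<^bsub>G\<^esub> v \<Longrightarrow> \<not> v \<rightarrow>\<^bsub>G\<^esub> u"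

definition contains_digraph :: "('a, 'b) pre_digraph \<Rightarrow> ('c, 'd) pre_digraph \<Rightarrow> bool" where
  "contains_digraph G F \<longleftrightarrow> (\<exists>H. subgraph H G \<and> digraph_iso F H)"

text \<open>Every finite digraph without multiple arcs is isomorphic to a pair digraph on natural
  numbers, so restricting the host graphs to this type loses nothing.\<close>

definition free_arc_counts :: "nat \<Rightarrow> ('c, 'd) pre_digraph \<Rightarrow> nat set" where
  "free_arc_counts n F = {card (arcs (with_proj G)) | G :: nat pair_pre_digraph.
     oriented_digraph (with_proj G) \<and> card (verts (with_proj G)) = n \<and>
     \<not> contains_digraph (with_proj G) F}"

definition ex_ori :: "nat \<Rightarrow> ('c, 'd) pre_digraph \<Rightarrow> nat" where
  "ex_ori n F = Max (free_arc_counts n F)"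

datatype diamond_vertex = X | Y1 | Y2 | Z

definition diamond :: "diamond_vertex pair_pre_digraph" where
  "diamond = \<lparr> pverts = {X, Y1, Y2, Z}, parcs = {(X, Y1), (X, Y2), (Y1, Z), (Y2, Z)} \<rparr>"

lemma oriented_digraph_diamond: "oriented_digraph (with_proj diamond)"
  by unfold_locales (auto simp: diamond_def arcs_ends_conv arc_to_ends_def)

text \<open>The maximum in the definition of the extremal number is a genuine one: the set is finite,
  and it is nonempty as soon as the forbidden graph has an arc.\<close>

lemma finite_free_arc_counts: "finite (free_arc_counts n F)"
proof (rule finite_subset)
  show "free_arc_counts n F \<subseteq> {..n * n}"
  proof
    fix m assume "m \<in> free_arc_counts n F"
    then obtain G :: "nat pair_pre_digraph" where m: "m = card (parcs G)"
      and o: "oriented_digraph (with_proj G)" and n: "card (pverts G) = n"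
      by (auto simp: free_arc_counts_def)
    interpret oriented_digraph "with_proj G" by (rule o)
    have "parcs G \<subseteq> pverts G \<times> pverts G"
      using tail_in_verts head_in_verts by fastforce
    moreover have "finite (pverts G)" using finite_verts by simp
    ultimately have "card (parcs G) \<le> card (pverts G \<times> pverts G)"
      by (intro card_mono) auto
    then show "m \<in> {..n * n}" using m n by (simp add: card_cartesian_product)
  qed
qed simp

lemma free_arc_counts_nonempty:
  assumes "arcs F \<noteq> {}"
  shows "0 \<in> free_arc_counts n F"
proof -
  let ?G = "\<lparr> pverts = {..<n}, parcs = {} \<rparr> :: nat pair_pre_digraph"
  have "oriented_digraph (with_proj ?G)"
    by unfold_locales (auto simp: arcs_ends_conv)
  moreover have "\<not> contains_digraph (with_proj ?G) F"
    using assms by (auto simp: contains_digraph_def subgraph_def digraph_iso_def)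
  ultimately show ?thesis
    unfolding free_arc_counts_def by (intro CollectI exI[of _ ?G]) auto
qed

end

theory Submission
  imports Defs
begin

text \<open>In a diamond-free oriented graph 2-paths are determined by their ends, so the out-neighbourhoods
  of the out-neighbours of a vertex are disjoint. Applied to a vertex \<open>x\<close> of maximum out-degree this
  gives \<open>n\<^sup>2/4 + n\<close> as a first bound, and if it is within \<open>n/2\<close> of being tight, all but \<open>O(n)\<close> arcs
  from the non-neighbours to the out-neighbours of \<open>x\<close> are present. Dropping boundedly many vertices leaves a core
  pair \<open>A, B\<close> with almost all arcs from \<open>A\<close> to \<open>B\<close>; counting 2-paths from \<open>A\<close> to \<open>B\<close> shows that
  each dropped vertex fits into one of the two sides, so \<open>V = A \<union> B\<close> with every row and column of
  \<open>A \<times> B\<close> almost full. Then a vertex has at most one out-neighbour in \<open>A\<close> and at most one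
  in-neighbour in \<open>B\<close>, arcs \<open>a \<rightarrow> a'\<close> inside \<open>A\<close> and \<open>b' \<rightarrow> b\<close> inside \<open>B\<close> force one of \<open>(a, b')\<close>,
  \<open>(a', b)\<close> not to be an arc, and these losses leave at most \<open>|A||B| + max |A| |B|\<close> arcs.
  The bound is attained by the complete orientation from \<open>A\<close> to \<open>B\<close> with a directed cycle on \<open>A\<close>.\<close>

section \<open>Counting arcs and elementary estimates\<close>

lemma card_rel_Times_out:
  assumes "finite A" "finite B"
  shows "card (R \<inter> A \<times> B) = (\<Sum>a\<in>A. card (R `` {a} \<inter> B))"
proof -
  have "R \<inter> A \<times> B = (SIGMA a:A. R `` {a} \<inter> B)" by auto
  then show ?thesis using assms by simp
qed

lemma card_rel_Times_in:
  assumes "finite A" "finite B"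
  shows "card (R \<inter> A \<times> B) = (\<Sum>b\<in>B. card (R\<inverse> `` {b} \<inter> A))"
proof -
  have "(R \<inter> A \<times> B)\<inverse> = R\<inverse> \<inter> B \<times> A" by auto
  then have "card (R \<inter> A \<times> B) = card (R\<inverse> \<inter> B \<times> A)" by (metis card_inverse)
  then show ?thesis using card_rel_Times_out[OF assms(2,1)] by simp
qed

text \<open>Markov's inequality for finite sums.\<close>

lemma card_le_sum_if_large:
  fixes f :: "'a \<Rightarrow> real" and c :: real
  assumes "finite A" "\<And>a. a \<in> A \<Longrightarrow> 0 \<le> f a"
  shows "card {a \<in> A. c < f a} * c \<le> sum f A"
proof -
  have "card {a \<in> A. c < f a} * c = (\<Sum>a\<in>{a \<in> A. c < f a}. c)" by simp
  also have "\<dots> \<le> (\<Sum>a\<in>{a \<in> A. c < f a}. f a)" by (intro sum_mono) auto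
  also have "\<dots> \<le> sum f A" using assms by (intro sum_mono2) auto
  finally show ?thesis .
qed

text \<open>For p \<ge> q the gap, multiplied by four and before rounding, is (p - q - 1)^2. This
  turns the bound for sides of sizes p and q into one in p + q alone.\<close>

lemma mult_plus_max_le:
  fixes p q :: nat
  shows "p * q + max p q \<le> (p + q + 1)\<^sup>2 div 4"
proof -
  have "int (4 * (p * q + max p q)) \<le> int ((p + q + 1)\<^sup>2)"
  proof (cases "q \<le> p")
    case True
    have "0 \<le> (int p - int q - 1)\<^sup>2" by simp
    then show ?thesis using True by (simp add: power2_eq_square algebra_simps max_def)
  next
    case False
    have "0 \<le> (int q - int p - 1)\<^sup>2" by simp
    then show ?thesis using False by (simp add: power2_eq_square algebra_simps max_def)
  qed
  then have "4 * (p * q + max p q) \<le> (p + q + 1)\<^sup>2" by (simp only: of_nat_le_iff)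
  then show ?thesis by (simp add: less_eq_div_iff_mult_less_eq mult.commute)
qed

lemma card_rel_Times_Un_le:
  "card (R \<inter> (I \<union> J) \<times> K) \<le> card (R \<inter> I \<times> K) + card (R \<inter> J \<times> K)"
  "card (R \<inter> K \<times> (I \<union> J)) \<le> card (R \<inter> K \<times> I) + card (R \<inter> K \<times> J)"
  by (simp_all add: Sigma_Un_distrib1 Times_Un_distrib1 Sigma_Un_distrib2 Int_Un_distrib card_Un_le)

section \<open>Diamond-free relations and nearly complete pairs\<close>

text \<open>Asymmetry already excludes loops and x = z, so \<open>mid_unique\<close> is exactly the
  absence of a diamond.\<close>

locale diamond_free =
  fixes V :: "'a set" and R :: "'a rel"
  assumes finite_V: "finite V"
    and R_subset: "R \<subseteq> V \<times> V"
    and asym: "(u, v) \<in> R \<Longrightarrow> (v, u) \<notin> R"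
    and mid_unique: "\<lbrakk>(x, y) \<in> R; (y, z) \<in> R; (x, y') \<in> R; (y', z) \<in> R\<rbrakk> \<Longrightarrow> y = y'"
begin

text \<open>The diamond is isomorphic to its reverse. Facts about a pair (A, B) thus dualize to (B,
  A), with in- and out-neighbours exchanged.\<close>

lemma reverse: "diamond_free V (R\<inverse>)"
proof
  show "finite V" by (rule finite_V)
  show "R\<inverse> \<subseteq> V \<times> V" using R_subset by auto
  show "(v, u) \<notin> R\<inverse>" if "(u, v) \<in> R\<inverse>" for u v using that asym by auto
  show "y = y'" if "(x, y) \<in> R\<inverse>" "(y, z) \<in> R\<inverse>" "(x, y') \<in> R\<inverse>" "(y', z) \<in> R\<inverse>" for x y z y'
    using that mid_unique[of z y x y'] by auto
qed

lemma finite_R: "finite R"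
  using finite_V R_subset by (meson finite_SigmaI finite_subset)

lemma finite_out [simp]: "finite (R `` {v})" and finite_in [simp]: "finite (R\<inverse> `` {v})"
  using finite_R by (auto simp: finite_Image)

lemma out_subset: "R `` {v} \<subseteq> V"
  using R_subset by auto

lemma sum_card_out_le:
  assumes "x \<in> V" "K \<subseteq> R `` {x}"
  shows "(\<Sum>y\<in>K. card (R `` {y})) \<le> card V - 1"
proof -
  have "finite K" using assms finite_subset finite_out by blast
  moreover have "R `` {y} \<inter> R `` {y'} = {}" if "y \<in> K" "y' \<in> K" "y \<noteq> y'" for y y'
    using that assms(2) mid_unique[of x y _ y'] by blast
  ultimately have "(\<Sum>y\<in>K. card (R `` {y})) = card (\<Union>y\<in>K. R `` {y})"
    by (intro card_UN_disjoint[symmetric]) auto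
  \<comment> \<open>By asymmetry no out-neighbour of \<open>x\<close> has an arc back to
    \<open>x\<close>; this saves one.\<close>
  also have "\<dots> \<le> card (V - {x})"
    using assms R_subset asym finite_V by (intro card_mono) auto
  finally show ?thesis using assms finite_V by simp
qed

text \<open>\<open>m\<close> is real because it will be a small fraction of \<open>card V\<close>. A
  pair without its arc from \<open>A\<close> to \<open>B\<close> counts as a defect even if the
  opposite arc is present.\<close>

definition nearly_complete :: "'a set \<Rightarrow> 'a set \<Rightarrow> real \<Rightarrow> bool" where
  "nearly_complete A B m \<longleftrightarrow> A \<subseteq> V \<and> B \<subseteq> V \<and> A \<inter> B = {} \<and> 0 \<le> m \<and>
     (\<forall>a\<in>A. real (card (B - R `` {a})) \<le> m) \<and> (\<forall>b\<in>B. real (card (A - R\<inverse> `` {b})) \<le> m)"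

lemma nearly_complete_reverse:
  "nearly_complete A B m \<Longrightarrow> diamond_free.nearly_complete V (R\<inverse>) B A m"
  using diamond_free.nearly_complete_def[OF reverse] unfolding nearly_complete_def by auto

text \<open>Two vertices of \<open>A\<close> together miss at most 2 m < |B| vertices of
  \<open>B\<close>, so they have a common out-neighbour there. A common in-neighbour
  \<open>v\<close>, wherever it lies, would complete a diamond.\<close>

lemma out_unique:
  fixes m :: real
  assumes nc: "nearly_complete A B m" and B: "2 * m < card B"
    and "a \<in> A" "a' \<in> A" "(v, a) \<in> R" "(v, a') \<in> R"
  shows "a = a'"
proof -
  have fB: "finite B" using nc finite_V finite_subset unfolding nearly_complete_def by blast
  have "\<not> B \<subseteq> (B - R `` {a}) \<union> (B - R `` {a'})"
  proof
    assume "B \<subseteq> (B - R `` {a}) \<union> (B - R `` {a'})"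
    then have "card B \<le> card ((B - R `` {a}) \<union> (B - R `` {a'}))"
      using fB by (intro card_mono) auto
    also have "\<dots> \<le> card (B - R `` {a}) + card (B - R `` {a'})" by (rule card_Un_le)
    finally have "real (card B) \<le> real (card (B - R `` {a})) + real (card (B - R `` {a'}))"
      by linarith
    also have "\<dots> \<le> m + m"
      using nc assms(3,4) unfolding nearly_complete_def by (intro add_mono) auto
    finally show False using B by simp
  qed
  then obtain b where "(a, b) \<in> R" "(a', b) \<in> R" by auto
  then show ?thesis using mid_unique assms(5,6) by blast
qed

lemma in_unique:
  fixes m :: real
  assumes nc: "nearly_complete A B m" and A: "2 * m < card A"
    and "b \<in> B" "b' \<in> B" "(b, v) \<in> R" "(b', v) \<in> R"
  shows "b = b'"
  using diamond_free.out_unique[OF reverse nearly_complete_reverse[OF nc] A, of b b' v] assms(3-)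
  by auto

lemma card_out_le_1:
  fixes m :: real
  assumes "nearly_complete A B m" "2 * m < card B"
  shows "card (R `` {v} \<inter> A) \<le> 1"
  using out_unique[OF assms] by (intro card_le_Suc0_iff_eq[THEN iffD2, simplified One_nat_def[symmetric]]) auto

lemma card_in_le_1:
  fixes m :: real
  assumes "nearly_complete A B m" "2 * m < card A"
  shows "card (R\<inverse> `` {v} \<inter> B) \<le> 1"
  using diamond_free.card_out_le_1[OF reverse nearly_complete_reverse[OF assms(1)] assms(2)] .

section \<open>Arcs inside the sides against nonadjacent pairs\<close>

definition nonadj :: "'a set \<Rightarrow> 'a set \<Rightarrow> 'a rel" where
  "nonadj A B = {(a, b). a \<in> A \<and> b \<in> B \<and> (a, b) \<notin> R \<and> (b, a) \<notin> R}"

definition out_active :: "'a set \<Rightarrow> 'a set" where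
  "out_active A = {a \<in> A. R `` {a} \<inter> A \<noteq> {}}"

definition in_active :: "'a set \<Rightarrow> 'a set" where
  "in_active B = {b \<in> B. R\<inverse> `` {b} \<inter> B \<noteq> {}}"

text \<open>Otherwise \<open>a'\<close> and \<open>b'\<close> are two middle vertices between
  \<open>a\<close> and \<open>b\<close>, distinct because the sides are disjoint.\<close>

lemma active_path_clash:
  assumes "A \<inter> B = {}" "(a, a') \<in> R" "a' \<in> A" "(b', b) \<in> R" "b' \<in> B" "(a, b') \<in> R"
  shows "(a', b) \<notin> R"
  using assms mid_unique[of a a' b b'] by blast

text \<open>Vertices of \<open>out_active A\<close> with a nonadjacent partner in \<open>B\<close>
  inject into \<open>nonadj A B\<close>, and at most one vertex has no partner. So a counterexample
  exceeds the bound by exactly one and is tight elsewhere: every vertex of \<open>B\<close> is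
  in-active and the chosen partners exhaust \<open>nonadj A B\<close>. Walking backwards along three
  vertices of \<open>B\<close> refutes this rigid case.\<close>

lemma active_bound_one_sided:
  fixes m :: real
  assumes nc: "nearly_complete A B m" and A: "6 * m < card A" and B: "6 * m < card B"
    and small: "card (out_active A) \<le> 2 * m"
  shows "card (out_active A) + card (in_active B) \<le> card (nonadj A B) + card B"
proof (rule ccontr)
  assume neg: "\<not> ?thesis"
  define A1 B1 where "A1 = out_active A" and "B1 = in_active B"
  have m: "0 \<le> m" and AB: "A \<inter> B = {}" and AV: "A \<subseteq> V" and BV: "B \<subseteq> V"
    and row: "\<And>a. a \<in> A \<Longrightarrow> card (B - R `` {a}) \<le> m"
    using nc unfolding nearly_complete_def by auto
  have fA: "finite A" and fB: "finite B" using AV BV finite_V finite_subset by blast+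
  have A1A: "A1 \<subseteq> A" and B1B: "B1 \<subseteq> B"
    unfolding A1_def B1_def out_active_def in_active_def by auto
  have fA1: "finite A1" and fB1: "finite B1" using A1A B1B fA fB finite_subset by blast+
  have fM: "finite (nonadj A B)"
    by (rule finite_subset[of _ "A \<times> B"]) (use fA fB in \<open>auto simp: nonadj_def\<close>)
  have out1: "a = a'" if "a \<in> A" "a' \<in> A" "(v, a) \<in> R" "(v, a') \<in> R" for a a' v
    using out_unique[OF nc _ that] B m by simp
  have in1: "b = b'" if "b \<in> B" "b' \<in> B" "(b, v) \<in> R" "(b', v) \<in> R" for b b' v
    using in_unique[OF nc _ that] A m by simp
  obtain \<phi> where \<phi>: "\<And>a. a \<in> A1 \<Longrightarrow> \<phi> a \<in> A \<and> (a, \<phi> a) \<in> R"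
  proof -
    have "\<forall>a\<in>A1. \<exists>a'. a' \<in> A \<and> (a, a') \<in> R" unfolding A1_def out_active_def by auto
    then show ?thesis using that by metis
  qed
  obtain \<pi> where \<pi>: "\<And>b. b \<in> B1 \<Longrightarrow> \<pi> b \<in> B \<and> (\<pi> b, b) \<in> R"
  proof -
    have "\<forall>b\<in>B1. \<exists>b'. b' \<in> B \<and> (b', b) \<in> R" unfolding B1_def in_active_def by auto
    then show ?thesis using that by metis
  qed
  have clash: "(\<phi> a, b) \<notin> R" if "a \<in> A1" "b \<in> B1" "(a, \<pi> b) \<in> R" for a b
    using active_path_clash[OF AB, of a "\<phi> a" "\<pi> b" b] \<phi> \<pi> that by blast
  have B1_large: "real (card B) - 2 * m < card B1"
    using neg small unfolding A1_def B1_def by linarith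
  \<comment> \<open>For \<open>b\<close> in \<open>B1\<close> outside \<open>N a\<close> the arc
    from \<open>\<phi> a\<close> to \<open>b\<close> is missing, which happens at most m times. So
    \<open>N a\<close> has more than |B| - 3 m elements, over half of |B|, and any two such sets
    meet.\<close>
  define N where "N a = {b \<in> B1. (a, \<pi> b) \<notin> R}" for a
  have N_large: "card B < 2 * card (N a)" if a: "a \<in> A1" for a
  proof -
    have "B1 \<subseteq> N a \<union> (B - R `` {\<phi> a})"
      using clash[OF a] B1B unfolding N_def by auto
    then have "card B1 \<le> card (N a \<union> (B - R `` {\<phi> a}))"
      using fB fB1 by (intro card_mono) (auto simp: N_def)
    also have "\<dots> \<le> card (N a) + card (B - R `` {\<phi> a})" by (rule card_Un_le)
    finally have "real (card B1) \<le> card (N a) + m" using row[of "\<phi> a"] \<phi>[OF a] by linarith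
    then show ?thesis using B1_large B by linarith
  qed
  define Free where "Free = {a \<in> A1. \<forall>b\<in>B. (a, b) \<notin> R \<longrightarrow> (b, a) \<in> R}"
  have Free_unique: "a = a'" if a: "a \<in> Free" and a': "a' \<in> Free" for a a'
  proof -
    have *: "a \<in> A1" "a' \<in> A1" using a a' unfolding Free_def by auto
    have "N a \<inter> N a' \<noteq> {}"
    proof
      assume "N a \<inter> N a' = {}"
      then have "card (N a) + card (N a') = card (N a \<union> N a')"
        using fB1 by (intro card_Un_disjoint[symmetric]) (auto simp: N_def)
      also have "\<dots> \<le> card B" using fB B1B by (intro card_mono) (auto simp: N_def)
      finally show False using N_large[OF *(1)] N_large[OF *(2)] by linarith
    qed
    \<comment> \<open>Neither free vertex sends an arc to \<open>\<pi> b\<close>, so both receive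
      one from it, against \<open>out_unique\<close>.\<close>
    then obtain b where b: "b \<in> B1" "(a, \<pi> b) \<notin> R" "(a', \<pi> b) \<notin> R" unfolding N_def by auto
    then have "(\<pi> b, a) \<in> R" "(\<pi> b, a') \<in> R" using a a' \<pi> unfolding Free_def by auto
    then show ?thesis using out1 * A1A by blast
  qed
  obtain g where g: "\<And>a. a \<in> A1 - Free \<Longrightarrow> (a, g a) \<in> nonadj A B"
  proof -
    have "\<forall>a\<in>A1 - Free. \<exists>b. (a, b) \<in> nonadj A B"
      using A1A unfolding Free_def nonadj_def by auto
    then show ?thesis using that by metis
  qed
  define H where "H = (\<lambda>a. (a, g a)) ` (A1 - Free)"
  have HM: "H \<subseteq> nonadj A B" using g unfolding H_def by auto
  have cardH: "card H = card (A1 - Free)" unfolding H_def by (intro card_image) (auto simp: inj_on_def)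
  have cF: "card (A1 - Free) = card A1 - card Free" and cF': "card Free \<le> card A1"
    using fA1 by (auto simp: Free_def intro!: card_Diff_subset card_mono)
  have cF1: "card Free \<le> 1"
    using Free_unique fA1 by (simp add: card_le_Suc0_iff_eq Free_def)
  have cHM: "card H \<le> card (nonadj A B)" using HM fM by (rule card_mono[rotated])
  have cB1: "card B1 \<le> card B" using B1B fB by (rule card_mono[rotated])
  have neg': "card (nonadj A B) + card B < card A1 + card B1"
    using neg unfolding A1_def B1_def by simp
  \<comment> \<open>\<open>card A1\<close> is at most \<open>card (nonadj A B)\<close> + 1 and
    \<open>card B1\<close> at most \<open>card B\<close>, so a strict violation forces equality
    throughout.\<close>
  have "card B1 = card B" "card H = card (nonadj A B)" "card Free = 1"
    using neg' cB1 cHM cF1 cF' cF unfolding cardH by linarith+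
  then have B1: "B1 = B" and H: "H = nonadj A B"
    using card_subset_eq[OF fB B1B] card_subset_eq[OF fM HM] by auto
  obtain a where a: "a \<in> Free" using \<open>card Free = 1\<close> by (metis card_eq_0_iff ex_in_conv zero_neq_one)
  then have aA1: "a \<in> A1" unfolding Free_def by auto
  have "N a \<noteq> {}" using N_large[OF aA1] by auto
  then obtain b0 where b0: "b0 \<in> B" "(a, \<pi> b0) \<notin> R" unfolding N_def B1 by auto
  define s where "s = \<pi> b0"
  have s: "s \<in> B" "(s, a) \<in> R" "(a, s) \<notin> R"
    using b0 \<pi>[of b0] a unfolding s_def Free_def B1 by auto
  have a_out: "(a, b) \<in> R" if "b \<in> B" "b \<noteq> s" for b
    using a that in1[of b s a] s unfolding Free_def by blast
  \<comment> \<open>Since \<open>s \<rightarrow> a\<close> and \<open>a\<close> dominates the rest of \<open>B\<close>, the children of \<open>s\<close> in \<open>B\<close> are childless in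
    \<open>B\<close>; hence none of \<open>s\<close> and its first two ancestors is a child of \<open>s\<close>.\<close>
  have childless: "(v, w) \<notin> R" if "v \<in> B" "w \<in> B" "(s, v) \<in> R" for v w
  proof
    assume vw: "(v, w) \<in> R"
    have "w \<noteq> s" using vw that asym by blast
    then have "a = v" using mid_unique[of s a w v] a_out[of w] that s vw by blast
    then show False using that aA1 A1A AB by blast
  qed
  define y z where "y = \<pi> s" and "z = \<pi> y"
  have y: "y \<in> B" "(y, s) \<in> R" using \<pi>[of s] s unfolding y_def B1 by auto
  have z: "z \<in> B" "(z, y) \<in> R" using \<pi>[of y] y unfolding z_def B1 by auto
  have distinct: "s \<noteq> y" "y \<noteq> z" "s \<noteq> z" using y z asym by blast+
  have pz: "\<pi> z \<in> B" "\<pi> z \<noteq> s" using \<pi>[of z] z childless[of z y] y unfolding B1 by auto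
  let ?c = "\<phi> a"
  have c: "?c \<in> A" using \<phi>[OF aA1] by simp
  \<comment> \<open>The clash applies to \<open>s\<close>, \<open>y\<close>, \<open>z\<close>
    because their chosen in-neighbours \<open>y\<close>, \<open>z\<close>, \<open>\<pi> z\<close>
    differ from \<open>s\<close> and so are out-neighbours of \<open>a\<close>.\<close>
  have cnot: "(?c, s) \<notin> R" "(?c, y) \<notin> R" "(?c, z) \<notin> R"
    using clash[OF aA1, of s] clash[OF aA1, of y] clash[OF aA1, of z] a_out s y z distinct pz
    unfolding B1 y_def[symmetric] z_def[symmetric] by auto
  \<comment> \<open>\<open>nonadj A B\<close> is the graph of the function \<open>g\<close>, so
    \<open>?c\<close> has at most one nonadjacent vertex in \<open>B\<close>. Hence two of
    \<open>s\<close>, \<open>y\<close>, \<open>z\<close> send an arc to \<open>?c\<close>,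
    contradicting \<open>in1\<close>.\<close>
  have two: "u = w" if "(?c, u) \<in> nonadj A B" "(?c, w) \<in> nonadj A B" for u w
    using that unfolding H[symmetric] H_def by auto
  have either: "(u, ?c) \<in> R \<or> (w, ?c) \<in> R"
    if "u \<in> B" "w \<in> B" "u \<noteq> w" "(?c, u) \<notin> R" "(?c, w) \<notin> R" for u w
    using two[of u w] that c unfolding nonadj_def by auto
  show False
    using either[of s y] either[of y z] either[of s z] in1[of s y ?c] in1[of y z ?c] in1[of s z ?c]
      cnot s(1) y(1) z(1) distinct by argo
qed

lemma nonadj_reverse: "diamond_free.nonadj (R\<inverse>) B A = (nonadj A B)\<inverse>"
  unfolding nonadj_def diamond_free.nonadj_def[OF reverse] by auto

lemma active_reverse:
  "diamond_free.out_active (R\<inverse>) B = in_active B"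
  "diamond_free.in_active (R\<inverse>) A = out_active A"
  unfolding in_active_def out_active_def diamond_free.in_active_def[OF reverse]
    diamond_free.out_active_def[OF reverse] by auto

text \<open>Each pair (a, b) of active vertices lacks the arc from \<open>\<phi> a\<close> to
  \<open>b\<close> or the one from \<open>a\<close> to \<open>\<pi> b\<close>. The first happens at
  most m times for fixed a, the second at most m times for fixed b. So |A1| |B1| \<le> m (|A1| +
  |B1|), which fails once both sizes exceed 2 m.\<close>

lemma active_small:
  fixes m :: real
  assumes nc: "nearly_complete A B m"
  shows "card (out_active A) \<le> 2 * m \<or> card (in_active B) \<le> 2 * m"
proof (rule ccontr)
  assume neg: "\<not> ?thesis"
  define A1 B1 where "A1 = out_active A" and "B1 = in_active B"
  have AB: "A \<inter> B = {}" and AV: "A \<subseteq> V" and BV: "B \<subseteq> V" and m: "0 \<le> m"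
    and row: "\<And>a. a \<in> A \<Longrightarrow> card (B - R `` {a}) \<le> m"
    and col: "\<And>b. b \<in> B \<Longrightarrow> card (A - R\<inverse> `` {b}) \<le> m"
    using nc unfolding nearly_complete_def by auto
  have fA: "finite A" and fB: "finite B" using AV BV finite_V finite_subset by blast+
  have A1A: "A1 \<subseteq> A" and B1B: "B1 \<subseteq> B"
    unfolding A1_def B1_def out_active_def in_active_def by auto
  have fA1: "finite A1" and fB1: "finite B1" using A1A B1B fA fB finite_subset by blast+
  have "\<forall>a\<in>A1. \<exists>a'. a' \<in> A \<and> (a, a') \<in> R" unfolding A1_def out_active_def by auto
  then obtain \<phi> where \<phi>: "\<And>a. a \<in> A1 \<Longrightarrow> \<phi> a \<in> A \<and> (a, \<phi> a) \<in> R" by metis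
  have "\<forall>b\<in>B1. \<exists>b'. b' \<in> B \<and> (b', b) \<in> R" unfolding B1_def in_active_def by auto
  then obtain \<pi> where \<pi>: "\<And>b. b \<in> B1 \<Longrightarrow> \<pi> b \<in> B \<and> (\<pi> b, b) \<in> R" by metis
  let ?X = "SIGMA a:A1. B - R `` {\<phi> a}" and ?Y = "SIGMA b:B1. A - R\<inverse> `` {\<pi> b}"
  have "(\<phi> a, b) \<notin> R \<or> (a, \<pi> b) \<notin> R" if "a \<in> A1" "b \<in> B1" for a b
    using active_path_clash[OF AB, of a "\<phi> a" "\<pi> b" b] \<phi>[OF that(1)] \<pi>[OF that(2)] by blast
  then have "A1 \<times> B1 \<subseteq> ?X \<union> ?Y\<inverse>" using A1A B1B by auto
  then have "card (A1 \<times> B1) \<le> card (?X \<union> ?Y\<inverse>)"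
    using fA fB fA1 fB1 by (intro card_mono) auto
  also have "\<dots> \<le> card ?X + card (?Y\<inverse>)" by (rule card_Un_le)
  also have "\<dots> = (\<Sum>a\<in>A1. card (B - R `` {\<phi> a})) + (\<Sum>b\<in>B1. card (A - R\<inverse> `` {\<pi> b}))"
    using fA fB fA1 fB1 by simp
  finally have "real (card (A1 \<times> B1)) \<le>
      (\<Sum>a\<in>A1. real (card (B - R `` {\<phi> a}))) + (\<Sum>b\<in>B1. real (card (A - R\<inverse> `` {\<pi> b})))"
    unfolding of_nat_sum[symmetric] of_nat_add[symmetric] of_nat_le_iff .
  also have "\<dots> \<le> (\<Sum>a\<in>A1. m) + (\<Sum>b\<in>B1. m)"
    using \<phi> \<pi> row col by (intro add_mono sum_mono) auto
  finally have le: "real (card A1) * card B1 \<le> card A1 * m + card B1 * m"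
    by (simp add: card_cartesian_product)
  have "2 * m < card A1" "2 * m < card B1" using neg unfolding A1_def B1_def by auto
  then have "2 * m * card B1 < real (card A1) * card B1" "2 * m * card A1 < real (card B1) * card A1"
    using m by (simp_all add: mult_strict_right_mono)
  then show False using le by (simp add: algebra_simps)
qed

lemma card_arcs_within:
  fixes m :: real
  assumes "nearly_complete A B m" "2 * m < card A" "2 * m < card B"
  shows "card (R \<inter> A \<times> A) \<le> card (out_active A)" "card (R \<inter> B \<times> B) \<le> card (in_active B)"
proof -
  have f: "finite A" "finite B"
    using assms(1) finite_V finite_subset unfolding nearly_complete_def by blast+
  have "card (R \<inter> A \<times> A) = (\<Sum>a\<in>A. card (R `` {a} \<inter> A))"
    using f by (intro card_rel_Times_out)
  also have "\<dots> = (\<Sum>a\<in>out_active A. card (R `` {a} \<inter> A))"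
    using f by (intro sum.mono_neutral_right) (auto simp: out_active_def)
  also have "\<dots> \<le> (\<Sum>a\<in>out_active A. 1)"
    using card_out_le_1[OF assms(1,3)] by (intro sum_mono)
  finally show "card (R \<inter> A \<times> A) \<le> card (out_active A)" by simp
  have "card (R \<inter> B \<times> B) = (\<Sum>b\<in>B. card (R\<inverse> `` {b} \<inter> B))"
    using f by (intro card_rel_Times_in)
  also have "\<dots> = (\<Sum>b\<in>in_active B. card (R\<inverse> `` {b} \<inter> B))"
    using f by (intro sum.mono_neutral_right) (auto simp: in_active_def)
  also have "\<dots> \<le> (\<Sum>b\<in>in_active B. 1)"
    using card_in_le_1[OF assms(1,2)] by (intro sum_mono)
  finally show "card (R \<inter> B \<times> B) \<le> card (in_active B)" by simp
qed

lemma card_arcs_between: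
  assumes "finite A" "finite B" "A \<inter> B = {}"
  shows "card (R \<inter> A \<times> B) + card (R \<inter> B \<times> A) + card (nonadj A B) = card A * card B"
proof -
  have f: "finite (A \<times> B)" "finite (B \<times> A)" using assms by auto
  have "A \<times> B = (R \<inter> A \<times> B) \<union> (R \<inter> B \<times> A)\<inverse> \<union> nonadj A B"
    unfolding nonadj_def by auto
  moreover have "card ((R \<inter> A \<times> B) \<union> (R \<inter> B \<times> A)\<inverse> \<union> nonadj A B)
      = card ((R \<inter> A \<times> B) \<union> (R \<inter> B \<times> A)\<inverse>) + card (nonadj A B)"
    using f by (intro card_Un_disjoint) (auto simp: nonadj_def intro: finite_subset[OF _ f(1)])
  moreover have "card ((R \<inter> A \<times> B) \<union> (R \<inter> B \<times> A)\<inverse>) = card (R \<inter> A \<times> B) + card ((R \<inter> B \<times> A)\<inverse>)"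
    using f asym by (intro card_Un_disjoint) auto
  moreover have "card (A \<times> B) = card A * card B" by (simp add: card_cartesian_product)
  ultimately show ?thesis by simp
qed

text \<open>Active vertices bound the arcs inside the sides, and each nonadjacent pair costs one of
  the |A| |B| possible arcs across. By \<open>active_small\<close>,
  \<open>active_bound_one_sided\<close> applies directly or after reversal, leaving a surplus of |B|
  or |A|.\<close>

lemma card_R_le_of_partition:
  fixes m :: real
  assumes nc: "nearly_complete A B m" and V: "A \<union> B = V"
    and A: "6 * m < card A" and B: "6 * m < card B"
  shows "card R \<le> card A * card B + max (card A) (card B)"
proof -
  have AB: "A \<inter> B = {}" and m: "0 \<le> m" using nc unfolding nearly_complete_def by auto
  have f: "finite A" "finite B" using V finite_V by auto
  have "card (out_active A) + card (in_active B) \<le> card (nonadj A B) + max (card A) (card B)"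
    using active_small[OF nc]
  proof
    assume "card (out_active A) \<le> 2 * m"
    then show ?thesis using active_bound_one_sided[OF nc A B] by linarith
  next
    assume "card (in_active B) \<le> 2 * m"
    then have "card (in_active B) + card (out_active A) \<le> card ((nonadj A B)\<inverse>) + card A"
      using diamond_free.active_bound_one_sided[OF reverse nearly_complete_reverse[OF nc] B A]
      unfolding active_reverse nonadj_reverse by simp
    then show ?thesis by simp
  qed
  moreover have "R = (R \<inter> A \<times> A) \<union> (R \<inter> B \<times> B) \<union> (R \<inter> A \<times> B) \<union> (R \<inter> B \<times> A)"
    using R_subset V by auto
  from arg_cong[OF this, of card]
  have "card R \<le> card (R \<inter> A \<times> A) + card (R \<inter> B \<times> B) + card (R \<inter> A \<times> B) + card (R \<inter> B \<times> A)"
    using card_Un_le[of "(R \<inter> A \<times> A) \<union> (R \<inter> B \<times> B) \<union> (R \<inter> A \<times> B)" "R \<inter> B \<times> A"]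
      card_Un_le[of "(R \<inter> A \<times> A) \<union> (R \<inter> B \<times> B)" "R \<inter> A \<times> B"]
      card_Un_le[of "R \<inter> A \<times> A" "R \<inter> B \<times> B"] by linarith
  moreover have "2 * m < card A" "2 * m < card B" using A B m by auto
  ultimately show ?thesis
    using card_arcs_within[OF nc] card_arcs_between[OF f AB] by linarith
qed

section \<open>A core pair from a vertex of maximum out-degree\<close>

text \<open>\<open>dense\<close> is what failure of the final bound provides. \<open>n18\<close>
  makes the square root of n / 2 at most n / 6, and \<open>n60\<close> keeps the at most 5 / e
  vertices dropped from each side within n / 12.\<close>

lemma core_exists:
  fixes e n :: real
  defines "n \<equiv> real (card V)"
  assumes dense: "n\<^sup>2 + 2 * n \<le> 4 * card R" and e: "0 < e" and n18: "18 \<le> n" and n60: "60 / e \<le> n"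
  obtains A B where "nearly_complete A B (e * n)" "card (V - (A \<union> B)) \<le> 10 / e"
    "n / 4 \<le> card A" "n / 4 \<le> card B"
proof -
  define d where "d v = real (card (R `` {v}))" for v
  have Vne: "V \<noteq> {}" using n18 unfolding n_def by auto
  then have "Max (d ` V) \<in> d ` V" using finite_V by (intro Max_in) auto
  then obtain x where x: "x \<in> V" and dx: "d x = Max (d ` V)" by force
  have max: "d v \<le> d x" if "v \<in> V" for v unfolding dx using finite_V that by (intro Max_ge) auto
  define S T where "S = R `` {x}" and "T = V - S"
  have SV: "S \<subseteq> V" unfolding S_def by (rule out_subset)
  have fS: "finite S" and fT: "finite T" using SV finite_V finite_subset unfolding T_def by auto
  have TV: "T \<subseteq> V" unfolding T_def by auto
  define \<Delta> where "\<Delta> = real (card S)"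
  have dx\<Delta>: "d x = \<Delta>" unfolding d_def \<Delta>_def S_def ..
  have cT: "real (card T) = n - \<Delta>"
    using card_Diff_subset[OF fS SV] card_mono[OF finite_V SV] unfolding T_def n_def \<Delta>_def
    by (simp add: of_nat_diff)
  have sum_out: "(\<Sum>y\<in>K. d y) \<le> n - 1" if "v \<in> V" "K \<subseteq> R `` {v}" for v K
  proof -
    have "real (\<Sum>y\<in>K. card (R `` {y})) \<le> real (card V - 1)"
      using sum_card_out_le[OF that] of_nat_mono by blast
    moreover have "1 \<le> card V" using Vne finite_V by (simp add: Suc_le_eq card_gt_0_iff)
    ultimately show ?thesis unfolding d_def n_def by (simp add: of_nat_diff)
  qed
  have "R \<inter> V \<times> V = R" using R_subset by auto
  moreover have "R `` {v} \<inter> V = R `` {v}" for v using out_subset by auto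
  ultimately have "card R = (\<Sum>v\<in>V. d v)"
    using card_rel_Times_out[OF finite_V finite_V, of R] unfolding d_def by simp
  also have "\<dots> = (\<Sum>v\<in>T. d v) + (\<Sum>v\<in>S. d v)"
    unfolding T_def using SV finite_V by (rule sum.subset_diff)
  finally have cardR: "card R = (\<Sum>v\<in>T. d v) + (\<Sum>v\<in>S. d v)" .
  \<comment> \<open>\<open>D\<close> is the total shortfall of out-degrees in \<open>T\<close> from
    the maximum. As |T| \<Delta> = n^2 / 4 - (\<Delta> - n / 2)^2 and at most n - 1 arcs leave
    vertices of \<open>S\<close>, density bounds both \<open>D\<close> and the imbalance of
    \<open>S\<close> and \<open>T\<close>.\<close>
  define D where "D = (\<Sum>t\<in>T. \<Delta> - d t)"
  have D_eq: "D = (n - \<Delta>) * \<Delta> - (\<Sum>v\<in>T. d v)"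
    unfolding D_def by (simp add: sum_subtractf cT)
  have D_pos: "0 \<le> D" unfolding D_def using max TV dx\<Delta> by (intro sum_nonneg) auto
  have "D \<le> (n - \<Delta>) * \<Delta> - card R + (n - 1)"
    using sum_out[OF x, of S] cardR unfolding D_eq S_def by simp
  then have D_le: "D \<le> n / 2 - 1 - (\<Delta> - n / 2)\<^sup>2"
    using dense by (simp add: power2_eq_square algebra_simps)
  then have D_le': "D \<le> n / 2" by (smt (verit) zero_le_power2)
  have "(\<Delta> - n / 2)\<^sup>2 \<le> n / 2" using D_le D_pos by linarith
  also have "\<dots> \<le> (n / 6)\<^sup>2"
  proof -
    have "18 * n \<le> n * n" using n18 by (intro mult_right_mono) auto
    then show ?thesis by (simp add: power2_eq_square)
  qed
  finally have "\<bar>\<Delta> - n / 2\<bar> \<le> n / 6"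
    using n18 by (simp add: abs_le_square_iff[symmetric])
  then have \<Delta>: "n / 3 \<le> \<Delta>" "\<Delta> \<le> 2 * n / 3" by linarith+
  \<comment> \<open>The out-degrees of the vertices of \<open>?K\<close> add up to at most n - 1,
    yet fall short of |K| \<Delta> by at most \<open>D\<close> \<le> n / 2. With \<Delta> \<ge> n /
    3 this gives |K| \<le> 9 / 2.\<close>
  have out_T: "card (R `` {v} \<inter> T) \<le> 9 / 2" if v: "v \<in> V" for v
  proof -
    let ?K = "R `` {v} \<inter> T"
    have "card ?K * \<Delta> = (\<Sum>y\<in>?K. d y) + (\<Sum>y\<in>?K. \<Delta> - d y)"
      by (simp add: sum_subtractf)
    also have "(\<Sum>y\<in>?K. d y) \<le> n - 1" using v by (intro sum_out) auto
    also have "(\<Sum>y\<in>?K. \<Delta> - d y) \<le> D"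
      unfolding D_def using fT max TV dx\<Delta> by (intro sum_mono2) auto
    finally have "card ?K * \<Delta> \<le> 3 * n / 2" using D_le' by simp
    moreover have "card ?K * (n / 3) \<le> card ?K * \<Delta>" using \<Delta> by (intro mult_left_mono) auto
    ultimately have "card ?K * (n / 3) \<le> 9 / 2 * (n / 3)" by simp
    then show ?thesis using n18 by simp
  qed
  \<comment> \<open>Arcs missing from \<open>t\<close> to \<open>S\<close> are due to a low
    out-degree or to arcs spent inside \<open>T\<close>.\<close>
  have row: "real (card (S - R `` {t})) = (\<Delta> - d t) + card (R `` {t} \<inter> T)" if "t \<in> T" for t
  proof -
    have "card (S - R `` {t}) + card (R `` {t} \<inter> S) = card S"
      using fS by (metis Int_commute card_Diff_subset_Int card_mono finite_Int inf_le1 le_add_diff_inverse2)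
    moreover have "card (R `` {t}) = card (R `` {t} \<inter> S) + card (R `` {t} \<inter> T)"
    proof -
      have "R `` {t} = (R `` {t} \<inter> S) \<union> (R `` {t} \<inter> T)" using out_subset unfolding T_def by auto
      moreover have "card ((R `` {t} \<inter> S) \<union> (R `` {t} \<inter> T)) = card (R `` {t} \<inter> S) + card (R `` {t} \<inter> T)"
        by (intro card_Un_disjoint) (auto simp: T_def)
      ultimately show ?thesis by simp
    qed
    ultimately show ?thesis unfolding d_def \<Delta>_def by linarith
  qed
  have "(\<Sum>t\<in>T. real (card (S - R `` {t}))) = D + (\<Sum>t\<in>T. real (card (R `` {t} \<inter> T)))"
    unfolding D_def using row by (simp add: sum.distrib)
  also have "\<dots> \<le> n / 2 + (\<Sum>t\<in>T. 9 / 2)"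
    using D_le' out_T TV by (intro add_mono sum_mono) auto
  also have "\<dots> = n / 2 + (n - \<Delta>) * (9 / 2)" using cT by simp
  also have "\<dots> \<le> 5 * n" using \<Delta> n18 by argo
  finally have rows: "(\<Sum>t\<in>T. real (card (S - R `` {t}))) \<le> 5 * n" .
  have "(\<Sum>t\<in>T. card ((- R) `` {t} \<inter> S)) = (\<Sum>s\<in>S. card ((- R)\<inverse> `` {s} \<inter> T))"
    using card_rel_Times_out[OF fT fS, of "- R"] card_rel_Times_in[OF fT fS, of "- R"] by simp
  moreover have "(- R) `` {t} \<inter> S = S - R `` {t}" "(- R)\<inverse> `` {t} \<inter> T = T - R\<inverse> `` {t}" for t by auto
  ultimately have "real (\<Sum>s\<in>S. card (T - R\<inverse> `` {s})) = real (\<Sum>t\<in>T. card (S - R `` {t}))"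
    by simp
  then have cols: "(\<Sum>s\<in>S. real (card (T - R\<inverse> `` {s}))) \<le> 5 * n"
    using rows by simp
  \<comment> \<open>At most 5 n arcs are missing in total, so at most 5 / e rows, and as many
    columns, can miss more than e n.\<close>
  define A where "A = {t \<in> T. card (S - R `` {t}) \<le> e * n}"
  define B where "B = {s \<in> S. card (T - R\<inverse> `` {s}) \<le> e * n}"
  have few: "real k \<le> 5 / e" if "k * (e * n) \<le> 5 * n" for k :: nat
    using that e n18 by (simp add: field_simps)
  have TA: "T - A = {t \<in> T. e * n < card (S - R `` {t})}" unfolding A_def by auto
  have SB: "S - B = {s \<in> S. e * n < card (T - R\<inverse> `` {s})}" unfolding B_def by auto
  have cTA: "card (T - A) \<le> 5 / e"
    unfolding TA using rows
      card_le_sum_if_large[OF fT, of "\<lambda>t. real (card (S - R `` {t}))" "e * n"] by (intro few) simp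
  have cSB: "card (S - B) \<le> 5 / e"
    unfolding SB using cols
      card_le_sum_if_large[OF fS, of "\<lambda>s. real (card (T - R\<inverse> `` {s}))" "e * n"] by (intro few) simp
  have AT: "A \<subseteq> T" and BS: "B \<subseteq> S" unfolding A_def B_def by auto
  have e5: "5 / e \<le> n / 12" using n60 by simp
  have "V - (A \<union> B) \<subseteq> (T - A) \<union> (S - B)" unfolding T_def by auto
  then have "card (V - (A \<union> B)) \<le> card ((T - A) \<union> (S - B))" using fT fS by (intro card_mono) auto
  also have "\<dots> \<le> card (T - A) + card (S - B)" by (rule card_Un_le)
  finally have "real (card (V - (A \<union> B))) \<le> real (card (T - A)) + real (card (S - B))" by linarith
  then have "card (V - (A \<union> B)) \<le> 10 / e" using cTA cSB by simp
  moreover have "nearly_complete A B (e * n)"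
    unfolding nearly_complete_def
  proof (intro conjI ballI)
    show "A \<subseteq> V" "B \<subseteq> V" using AT BS TV SV by auto
    show "A \<inter> B = {}" using AT BS unfolding T_def by auto
    show "0 \<le> e * n" using e n18 by simp
    fix a assume a: "a \<in> A"
    have "card (B - R `` {a}) \<le> card (S - R `` {a})" using BS fS by (intro card_mono) auto
    then show "real (card (B - R `` {a})) \<le> e * n" using a unfolding A_def by auto
  next
    fix b assume b: "b \<in> B"
    have "card (A - R\<inverse> `` {b}) \<le> card (T - R\<inverse> `` {b})" using AT fT by (intro card_mono) auto
    then show "real (card (A - R\<inverse> `` {b})) \<le> e * n" using b unfolding B_def by auto
  qed
  moreover have "card T = card A + card (T - A)" "card S = card B + card (S - B)"
    using AT BS fT fS by (metis card_Diff_subset card_mono finite_subset le_add_diff_inverse)+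
  then have "n / 4 \<le> card A" "n / 4 \<le> card B"
    using cTA cSB e5 cT \<Delta> unfolding \<Delta>_def by linarith+
  ultimately show ?thesis using that by blast
qed

section \<open>Vertices outside the core\<close>

text \<open>The boxes of in-neighbours in \<open>A\<close> times out-neighbours in \<open>B\<close>
  are disjoint for distinct middle vertices, by \<open>mid_unique\<close>.\<close>

lemma sum_in_out_le:
  assumes "finite A" "finite B"
  shows "(\<Sum>v\<in>V. card (R\<inverse> `` {v} \<inter> A) * card (R `` {v} \<inter> B)) \<le> card A * card B"
proof -
  let ?W = "\<lambda>v. (R\<inverse> `` {v} \<inter> A) \<times> (R `` {v} \<inter> B)"
  have "(\<Sum>v\<in>V. card (R\<inverse> `` {v} \<inter> A) * card (R `` {v} \<inter> B)) = (\<Sum>v\<in>V. card (?W v))"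
    by (simp add: card_cartesian_product)
  also have "\<dots> = card (\<Union>v\<in>V. ?W v)"
  proof (rule card_UN_disjoint[symmetric, OF finite_V])
    show "\<forall>v\<in>V. finite (?W v)" using assms by auto
    have "v = w" if "p \<in> ?W v" "p \<in> ?W w" for p v w
      using that mid_unique[of "fst p" v "snd p" w] by auto
    then show "\<forall>v\<in>V. \<forall>w\<in>V. v \<noteq> w \<longrightarrow> ?W v \<inter> ?W w = {}" by blast
  qed
  also have "\<dots> \<le> card (A \<times> B)" using assms by (intro card_mono) auto
  finally show ?thesis by (simp add: card_cartesian_product)
qed

text \<open>For every vertex \<open>v\<close> outside the core \<open>A \<union> B\<close>, with \<open>p\<close> out-neighbours in \<open>B\<close> and \<open>q\<close>
  in-neighbours in \<open>A\<close>, one has \<open>\<alpha> p + \<beta> q = p q + \<alpha> \<beta> - (\<beta> - p) (\<alpha> - q)\<close>. The products \<open>p q\<close>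
  count 2-paths from \<open>A\<close> to \<open>B\<close>, so their sum is bounded, and a vertex that is far from joining
  either side costs a quadratic amount.\<close>

lemma core_area_bound:
  fixes m \<alpha> \<beta> c :: real
  assumes nc: "nearly_complete A B m" and A: "2 * m < card A" and B: "2 * m < card B"
  defines "\<alpha> \<equiv> real (card A)" and "\<beta> \<equiv> real (card B)" and "c \<equiv> real (card (V - (A \<union> B)))"
  assumes v: "v \<in> V - (A \<union> B)"
  shows "min \<alpha> \<beta> * (card R - \<alpha> * \<beta> - 2 * c - c\<^sup>2) \<le>
    \<alpha> * \<beta> * (1 + c) + m * (\<alpha> + \<beta>) - card (B - R `` {v}) * card (A - R\<inverse> `` {v})"
proof -
  define C where "C = V - (A \<union> B)"
  have AV: "A \<subseteq> V" and BV: "B \<subseteq> V" and AB: "A \<inter> B = {}" and m: "0 \<le> m"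
    and row: "\<And>a. a \<in> A \<Longrightarrow> card (B - R `` {a}) \<le> m"
    and col: "\<And>b. b \<in> B \<Longrightarrow> card (A - R\<inverse> `` {b}) \<le> m"
    using nc unfolding nearly_complete_def by auto
  have fA: "finite A" and fB: "finite B" and fC: "finite C"
    using AV BV finite_V finite_subset unfolding C_def by blast+
  define P where "P u = real (card (R `` {u} \<inter> B))" for u
  define Q where "Q u = real (card (R\<inverse> `` {u} \<inter> A))" for u
  have coP: "real (card (B - R `` {u})) = \<beta> - P u" for u
    unfolding P_def \<beta>_def using fB
    by (metis Int_commute card_Diff_subset_Int card_mono finite_Int inf_le1 of_nat_diff)
  have coQ: "real (card (A - R\<inverse> `` {u})) = \<alpha> - Q u" for u
    unfolding Q_def \<alpha>_def using fA
    by (metis Int_commute card_Diff_subset_Int card_mono finite_Int inf_le1 of_nat_diff)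
  have P0: "0 \<le> P u" "0 \<le> Q u" "P u \<le> \<beta>" "Q u \<le> \<alpha>" for u
    using coP[of u] coQ[of u] unfolding P_def Q_def by linarith+
  have sumQA: "card (R \<inter> A \<times> A) = (\<Sum>u\<in>A. Q u)"
    unfolding Q_def using card_rel_Times_in[OF fA fA, of R] by simp
  have sumPB: "card (R \<inter> B \<times> B) = (\<Sum>u\<in>B. P u)"
    unfolding P_def using card_rel_Times_out[OF fB fB, of R] by simp
  have a0: "(\<Sum>u\<in>A. Q u) \<le> \<alpha>"
  proof -
    have "card (R \<inter> A \<times> A) \<le> card A"
      using card_arcs_within(1)[OF nc A B] card_mono[OF fA, of "out_active A"]
      by (auto simp: out_active_def)
    then show ?thesis using sumQA unfolding \<alpha>_def by linarith
  qed
  have b0: "(\<Sum>u\<in>B. P u) \<le> \<beta>"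
  proof -
    have "card (R \<inter> B \<times> B) \<le> card B"
      using card_arcs_within(2)[OF nc A B] card_mono[OF fB, of "in_active B"]
      by (auto simp: in_active_def)
    then show ?thesis using sumPB unfolding \<beta>_def by linarith
  qed
  \<comment> \<open>\<alpha> \<beta> covers both directions between \<open>A\<close> and
    \<open>B\<close>. Each vertex of \<open>C\<close> sends at most one arc to \<open>A\<close> and
    receives at most one from \<open>B\<close>, which gives 2 c; c^2 bounds the arcs inside
    \<open>C\<close>.\<close>
  have card_R: "card R \<le> \<alpha> * \<beta> + (\<Sum>u\<in>A. Q u) + (\<Sum>u\<in>B. P u) + (\<Sum>u\<in>C. P u + Q u) + 2 * c + c\<^sup>2"
  proof -
    let ?V = "A \<union> B \<union> C"
    have RV: "R \<inter> ?V \<times> ?V = R" using R_subset unfolding C_def by auto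
    have "card R \<le> card (R \<inter> A \<times> ?V) + card (R \<inter> B \<times> ?V) + card (R \<inter> C \<times> ?V)"
      using card_rel_Times_Un_le(1)[of R "A \<union> B" C ?V] card_rel_Times_Un_le(1)[of R A B ?V] unfolding RV by linarith
    moreover have "card (R \<inter> I \<times> ?V) \<le> card (R \<inter> I \<times> A) + card (R \<inter> I \<times> B) + card (R \<inter> I \<times> C)" for I
      using card_rel_Times_Un_le(2)[of R I "A \<union> B" C] card_rel_Times_Un_le(2)[of R I A B] by linarith
    note this[of A] this[of B] this[of C]
    ultimately have *: "card R \<le> card (R \<inter> A \<times> A) + card (R \<inter> B \<times> B) + (card (R \<inter> A \<times> B) + card (R \<inter> B \<times> A))
      + card (R \<inter> C \<times> B) + card (R \<inter> A \<times> C) + card (R \<inter> C \<times> A) + card (R \<inter> B \<times> C) + card (R \<inter> C \<times> C)"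
      by linarith
    have "card (R \<inter> A \<times> B) + card (R \<inter> B \<times> A) \<le> card A * card B"
      using card_arcs_between[OF fA fB AB] by linarith
    then have 1: "real (card (R \<inter> A \<times> B)) + card (R \<inter> B \<times> A) \<le> \<alpha> * \<beta>"
      unfolding \<alpha>_def \<beta>_def of_nat_add[symmetric] of_nat_mult[symmetric] of_nat_le_iff .
    have 2: "card (R \<inter> C \<times> B) = (\<Sum>u\<in>C. P u)"
      unfolding P_def using card_rel_Times_out[OF fC fB, of R] by simp
    have 3: "card (R \<inter> A \<times> C) = (\<Sum>u\<in>C. Q u)"
      unfolding Q_def using card_rel_Times_in[OF fA fC, of R] by simp
    have "card (R \<inter> C \<times> A) \<le> (\<Sum>u\<in>C. 1)"
      unfolding card_rel_Times_out[OF fC fA] by (intro sum_mono card_out_le_1[OF nc B])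
    then have 4: "card (R \<inter> C \<times> A) \<le> c" unfolding c_def C_def by simp
    have "card (R \<inter> B \<times> C) \<le> (\<Sum>u\<in>C. 1)"
      unfolding card_rel_Times_in[OF fB fC] by (intro sum_mono card_in_le_1[OF nc A])
    then have 5: "card (R \<inter> B \<times> C) \<le> c" unfolding c_def C_def by simp
    have "card (R \<inter> C \<times> C) \<le> card (C \<times> C)" using fC by (intro card_mono) auto
    then have "real (card (R \<inter> C \<times> C)) \<le> real (card (C \<times> C))" by (rule of_nat_mono)
    then have 6: "card (R \<inter> C \<times> C) \<le> c\<^sup>2"
      unfolding c_def C_def[symmetric] by (simp add: card_cartesian_product power2_eq_square)
    show ?thesis using * 1 2 3 4 5 6 sumQA sumPB unfolding sum.distrib by linarith
  qed
  have "V = A \<union> B \<union> C" unfolding C_def using AV BV by auto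
  moreover have "(A \<union> B) \<inter> C = {}" unfolding C_def by auto
  ultimately have "(\<Sum>u\<in>V. P u * Q u) = (\<Sum>u\<in>A. P u * Q u) + (\<Sum>u\<in>B. P u * Q u) + (\<Sum>u\<in>C. P u * Q u)"
    using AB fA fB fC by (simp add: sum.union_disjoint)
  moreover have "real (\<Sum>v\<in>V. card (R\<inverse> `` {v} \<inter> A) * card (R `` {v} \<inter> B)) \<le> real (card A * card B)"
    using sum_in_out_le[OF fA fB] by (rule of_nat_mono)
  then have "(\<Sum>u\<in>V. P u * Q u) \<le> \<alpha> * \<beta>"
    unfolding P_def Q_def \<alpha>_def \<beta>_def by (simp add: mult.commute)
  ultimately have area: "(\<Sum>u\<in>A. P u * Q u) + (\<Sum>u\<in>B. P u * Q u) + (\<Sum>u\<in>C. P u * Q u) \<le> \<alpha> * \<beta>"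
    by simp
  \<comment> \<open>A vertex of \<open>A\<close> has at least \<beta> - m out-neighbours in
    \<open>B\<close>, so each arc inside \<open>A\<close> extends to that many 2-paths into
    \<open>B\<close>; dually for arcs inside \<open>B\<close>.\<close>
  have "(\<Sum>u\<in>A. (\<beta> - m) * Q u) \<le> (\<Sum>u\<in>A. P u * Q u)"
    using row coP P0 by (intro sum_mono mult_right_mono) (auto simp: algebra_simps)
  then have areaA: "(\<beta> - m) * (\<Sum>u\<in>A. Q u) \<le> (\<Sum>u\<in>A. P u * Q u)" by (simp add: sum_distrib_left)
  have "(\<Sum>u\<in>B. P u * (\<alpha> - m)) \<le> (\<Sum>u\<in>B. P u * Q u)"
    using col coQ P0 by (intro sum_mono mult_left_mono) (auto simp: algebra_simps)
  then have areaB: "(\<Sum>u\<in>B. P u) * (\<alpha> - m) \<le> (\<Sum>u\<in>B. P u * Q u)" by (simp add: sum_distrib_right)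
  let ?\<mu> = "min \<alpha> \<beta>"
  have \<mu>: "?\<mu> \<le> \<alpha>" "?\<mu> \<le> \<beta>" by auto
  \<comment> \<open>The weights of \<open>P u\<close> and \<open>Q u\<close> are lowered to the
    minimum of \<alpha> and \<beta>, so that all arc counts share one weight.\<close>
  have "(\<Sum>u\<in>C. ?\<mu> * (P u + Q u) - \<alpha> * \<beta> + (\<beta> - P u) * (\<alpha> - Q u)) \<le> (\<Sum>u\<in>C. P u * Q u)"
  proof (rule sum_mono)
    fix u
    have "?\<mu> * P u \<le> \<alpha> * P u" "?\<mu> * Q u \<le> \<beta> * Q u" using \<mu> P0 by (auto intro: mult_right_mono)
    then show "?\<mu> * (P u + Q u) - \<alpha> * \<beta> + (\<beta> - P u) * (\<alpha> - Q u) \<le> P u * Q u"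
      by (simp add: algebra_simps)
  qed
  then have "?\<mu> * (\<Sum>u\<in>C. P u + Q u) - c * (\<alpha> * \<beta>) + (\<Sum>u\<in>C. (\<beta> - P u) * (\<alpha> - Q u)) \<le> (\<Sum>u\<in>C. P u * Q u)"
    by (simp add: sum.distrib sum_subtractf sum_distrib_left[symmetric] c_def C_def[symmetric])
  moreover have "(\<beta> - P v) * (\<alpha> - Q v) \<le> (\<Sum>u\<in>C. (\<beta> - P u) * (\<alpha> - Q u))"
    using v fC P0 unfolding C_def[symmetric] by (intro member_le_sum) auto
  ultimately have areaC: "?\<mu> * (\<Sum>u\<in>C. P u + Q u) - c * (\<alpha> * \<beta>) + (\<beta> - P v) * (\<alpha> - Q v) \<le> (\<Sum>u\<in>C. P u * Q u)"
    by linarith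
  have "?\<mu> * (card R - \<alpha> * \<beta> - 2 * c - c\<^sup>2) \<le> ?\<mu> * ((\<Sum>u\<in>A. Q u) + (\<Sum>u\<in>B. P u) + (\<Sum>u\<in>C. P u + Q u))"
    using card_R by (intro mult_left_mono) (auto simp: \<alpha>_def \<beta>_def)
  moreover have "?\<mu> * (\<Sum>u\<in>A. Q u) \<le> \<beta> * (\<Sum>u\<in>A. Q u)" "?\<mu> * (\<Sum>u\<in>B. P u) \<le> \<alpha> * (\<Sum>u\<in>B. P u)"
    using \<mu> P0 by (auto intro!: mult_right_mono sum_nonneg)
  \<comment> \<open>This repays the m lost in the weights \<beta> - m and \<alpha> - m.\<close>
  moreover have "m * (\<Sum>u\<in>A. Q u) \<le> m * \<alpha>" "m * (\<Sum>u\<in>B. P u) \<le> m * \<beta>"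
    using a0 b0 m by (auto intro: mult_left_mono)
  ultimately have "?\<mu> * (card R - \<alpha> * \<beta> - 2 * c - c\<^sup>2) \<le> \<alpha> * \<beta> * (1 + c) + m * (\<alpha> + \<beta>) - (\<beta> - P v) * (\<alpha> - Q v)"
    using area areaA areaB areaC by (simp add: algebra_simps)
  then show ?thesis unfolding of_nat_mult coP coQ .
qed

section \<open>The upper bound\<close>

text \<open>With e = 1 / 3200 the core omits at most 10 / e = 32000 vertices. The threshold 10^13
  makes n / 800 exceed the terms quadratic in that number.\<close>

lemma card_R_le:
  assumes large: "10 ^ 13 \<le> card V"
  shows "card R \<le> (card V + 1)\<^sup>2 div 4"
proof (rule ccontr)
  assume neg: "\<not> ?thesis"
  define n where "n = real (card V)"
  have "real (10 ^ 13) \<le> n" unfolding n_def using large by (rule of_nat_mono)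
  then have n: "10 ^ 13 \<le> n" and n0: "0 < n" by simp_all
  have "(card V + 1)\<^sup>2 \<le> 4 * card R" using neg by linarith
  then have "real ((card V + 1)\<^sup>2) \<le> real (4 * card R)" by (rule of_nat_mono)
  then have dense: "n\<^sup>2 + 2 * n \<le> 4 * real (card R)"
    unfolding n_def by (simp add: power2_eq_square algebra_simps)
  obtain A B where nc: "nearly_complete A B (1 / 3200 * n)"
    and c_le: "card (V - (A \<union> B)) \<le> 10 / (1 / 3200 :: real)"
    and cA: "n / 4 \<le> card A" and cB: "n / 4 \<le> card B"
    using core_exists[of "1 / 3200"] dense n unfolding n_def by auto
  define \<alpha> \<beta> c where "\<alpha> = real (card A)" and "\<beta> = real (card B)" and "c = real (card (V - (A \<union> B)))"
  have AV: "A \<subseteq> V" and BV: "B \<subseteq> V" and AB: "A \<inter> B = {}"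
    and row: "\<And>a. a \<in> A \<Longrightarrow> card (B - R `` {a}) \<le> 1 / 3200 * n"
    and col: "\<And>b. b \<in> B \<Longrightarrow> card (A - R\<inverse> `` {b}) \<le> 1 / 3200 * n"
    using nc unfolding nearly_complete_def by auto
  have fA: "finite A" and fB: "finite B" using AV BV finite_V finite_subset by blast+
  have c: "0 \<le> c" "c \<le> 32000" using c_le unfolding c_def by auto
  have "card V = card (A \<union> B) + card (V - (A \<union> B))"
    using AV BV finite_V by (metis Un_least card_Diff_subset card_mono finite_subset le_add_diff_inverse)
  then have n_eq: "n = \<alpha> + \<beta> + c"
    unfolding n_def \<alpha>_def \<beta>_def c_def using AB fA fB by (simp add: card_Un_disjoint)
  \<comment> \<open>A violating vertex costs n^2 / 1600, twice the error term m n of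
    \<open>core_area_bound\<close>. After division by \<mu> \<le> n a loss of n / 3200
    remains.\<close>
  have outside: "card (B - R `` {v}) * card (A - R\<inverse> `` {v}) \<le> n\<^sup>2 / 1600"
    if v: "v \<in> V - (A \<union> B)" for v
  proof (rule ccontr)
    assume far: "\<not> ?thesis"
    let ?X = "card R - \<alpha> * \<beta> - 2 * c - c\<^sup>2" and ?\<mu> = "min \<alpha> \<beta>" and ?M = "max \<alpha> \<beta>"
    have \<mu>: "0 < ?\<mu>" "?\<mu> \<le> n" using cA cB n c n_eq unfolding \<alpha>_def \<beta>_def by auto
    have "?\<mu> * ?X \<le> \<alpha> * \<beta> * (1 + c) + 1 / 3200 * n * (\<alpha> + \<beta>)
        - card (B - R `` {v}) * card (A - R\<inverse> `` {v})"
      unfolding \<alpha>_def \<beta>_def c_def using cA cB n0 by (intro core_area_bound[OF nc _ _ v]) linarith+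
    also have "\<dots> \<le> \<alpha> * \<beta> * (1 + c) + 1 / 3200 * n * n - n\<^sup>2 / 1600"
      using far n_eq c n by (intro diff_mono add_left_mono mult_left_mono) auto
    also have "\<dots> = ?\<mu> * ?M * (1 + c) - n * n / 3200"
      by (simp add: power2_eq_square min_def max_def)
    also have "\<dots> \<le> ?\<mu> * ?M * (1 + c) - ?\<mu> * n / 3200"
      using \<mu> n by (intro diff_left_mono divide_right_mono mult_right_mono) auto
    also have "\<dots> = ?\<mu> * (?M * (1 + c) - n / 3200)" by (simp add: algebra_simps)
    finally have "?X \<le> ?M * (1 + c) - n / 3200" using \<mu>(1) by simp
    then have X: "n\<^sup>2 + 2 * n - 4 * \<alpha> * \<beta> - 8 * c - 4 * c\<^sup>2 \<le> 4 * ?M * (1 + c) - n / 800"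
      using dense by (simp add: algebra_simps)
    define d where "d = \<bar>\<alpha> - \<beta>\<bar>"
    have M: "?M = (\<alpha> + \<beta> + d) / 2" and d2: "d\<^sup>2 = (\<alpha> - \<beta>)\<^sup>2" unfolding d_def by (auto simp: max_def)
    \<comment> \<open>Substituting n = \<alpha> + \<beta> + c completes a square in the imbalance
      \<open>d\<close>, so only terms in \<open>c\<close> stand against n / 800.\<close>
    have "n\<^sup>2 + 2 * n - 4 * \<alpha> * \<beta> - 8 * c - 4 * c\<^sup>2 - 4 * ?M * (1 + c)
        = (d - (1 + c))\<^sup>2 - (1 + c)\<^sup>2 - 6 * c - 3 * c\<^sup>2"
      unfolding M n_eq using d2 by (simp add: power2_eq_square field_simps)
    then have "n / 800 \<le> (1 + c)\<^sup>2 + 6 * c + 3 * c\<^sup>2" using X by (smt (verit) zero_le_power2)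
    also have "\<dots> \<le> (1 + 32000)\<^sup>2 + 6 * 32000 + 3 * 32000\<^sup>2"
      using c by (intro add_mono mult_left_mono power_mono) auto
    finally show False using n by simp
  qed
  \<comment> \<open>As n^2 / 1600 = (n / 40)^2, each outside vertex has a defect of at most n / 40
    towards one side and joins the other. The added vertices raise defects to at most n / 40 + n /
    120 = n / 30, and 6 n / 30 < n / 4 as \<open>card_R_le_of_partition\<close> requires.\<close>
  define A' where "A' = A \<union> {v \<in> V - (A \<union> B). card (B - R `` {v}) \<le> n / 40}"
  define B' where "B' = V - A'"
  have far: "card (A - R\<inverse> `` {v}) \<le> n / 40"
    if v: "v \<in> V - (A \<union> B)" "n / 40 < card (B - R `` {v})" for v
  proof (rule ccontr)
    assume "\<not> ?thesis"
    then have "(n / 40) * (n / 40) < card (B - R `` {v}) * card (A - R\<inverse> `` {v})"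
      unfolding of_nat_mult using v(2) n by (intro mult_strict_mono) auto
    then show False using outside[OF v(1)] by (simp add: power2_eq_square)
  qed
  have A'V: "A' \<subseteq> V" and B'V: "B' \<subseteq> V" and AA': "A \<subseteq> A'" and BB': "B \<subseteq> B'"
    and B'_sub: "B' \<subseteq> B \<union> (V - (A \<union> B))" and A'_sub: "A' \<subseteq> A \<union> (V - (A \<union> B))"
    using AV BV AB unfolding A'_def B'_def by auto
  have c_small: "c \<le> n / 120" using c n by simp
  have nc': "nearly_complete A' B' (n / 30)"
    unfolding nearly_complete_def
  proof (intro conjI ballI)
    show "A' \<subseteq> V" "B' \<subseteq> V" "A' \<inter> B' = {}" "0 \<le> n / 30" using A'V B'V n unfolding B'_def by auto
    fix a assume "a \<in> A'"
    then have a: "card (B - R `` {a}) \<le> n / 40" using row n unfolding A'_def by fastforce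
    have "B' - R `` {a} \<subseteq> (B - R `` {a}) \<union> (V - (A \<union> B))" using B'_sub by auto
    then have "card (B' - R `` {a}) \<le> card ((B - R `` {a}) \<union> (V - (A \<union> B)))"
      using fB finite_V by (intro card_mono) auto
    also have "\<dots> \<le> card (B - R `` {a}) + card (V - (A \<union> B))" by (rule card_Un_le)
    finally show "real (card (B' - R `` {a})) \<le> n / 30" using a c_small unfolding c_def by linarith
  next
    fix b assume "b \<in> B'"
    then have b: "card (A - R\<inverse> `` {b}) \<le> n / 40"
      using col[of b] far[of b] n unfolding A'_def B'_def by fastforce
    have "A' - R\<inverse> `` {b} \<subseteq> (A - R\<inverse> `` {b}) \<union> (V - (A \<union> B))" using A'_sub by auto
    then have "card (A' - R\<inverse> `` {b}) \<le> card ((A - R\<inverse> `` {b}) \<union> (V - (A \<union> B)))"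
      using fA finite_V by (intro card_mono) auto
    also have "\<dots> \<le> card (A - R\<inverse> `` {b}) + card (V - (A \<union> B))" by (rule card_Un_le)
    finally show "real (card (A' - R\<inverse> `` {b})) \<le> n / 30" using b c_small unfolding c_def by linarith
  qed
  have fA': "finite A'" and fB': "finite B'" using A'V B'V finite_V finite_subset by blast+
  have "card A \<le> card A'" "card B \<le> card B'" using AA' BB' fA' fB' card_mono by blast+
  then have "6 * (n / 30) < card A'" "6 * (n / 30) < card B'" using cA cB n0 by linarith+
  moreover have V: "A' \<union> B' = V" using A'V unfolding B'_def by auto
  ultimately have bound: "card R \<le> card A' * card B' + max (card A') (card B')"
    using card_R_le_of_partition[OF nc'] by simp
  have "card V = card A' + card B'"
    using V fA' fB' card_Un_disjoint[of A' B'] unfolding B'_def by auto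
  then have "card R \<le> (card V + 1)\<^sup>2 div 4" using bound mult_plus_max_le[of "card A'" "card B'"] by simp
  then show False using neg by simp
qed

end

section \<open>Translation between digraphs and relations\<close>

lemma diamond_free_if_not_contains:
  fixes G :: "'a pair_pre_digraph"
  assumes G: "oriented_digraph (with_proj G)"
    and free: "\<not> contains_digraph (with_proj G) (with_proj diamond)"
  shows "diamond_free (pverts G) (parcs G)"
proof -
  interpret oriented_digraph "with_proj G" by (rule G)
  have wf: "fst a \<in> pverts G" "snd a \<in> pverts G" if "a \<in> parcs G" for a
    using tail_in_verts[of a] head_in_verts[of a] that by auto
  have asym: "(v, u) \<notin> parcs G" if "(u, v) \<in> parcs G" for u v
    using no_opposite_arcs[of u v] that by simp
  show ?thesis
  proof
    show "finite (pverts G)" using finite_verts by simp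
    show "parcs G \<subseteq> pverts G \<times> pverts G" using wf by fastforce
    show "(v, u) \<notin> parcs G" if "(u, v) \<in> parcs G" for u v using asym[OF that] .
    fix x y z y'
    assume arcs: "(x, y) \<in> parcs G" "(y, z) \<in> parcs G" "(x, y') \<in> parcs G" "(y', z) \<in> parcs G"
    show "y = y'"
    proof (rule ccontr)
      assume "y \<noteq> y'"
      \<comment> \<open>All inequalities except y \<noteq> y' come from the absence of loops and
        opposite arcs.\<close>
      then have dist: "distinct [x, y, y', z]" using arcs asym by auto
      define f where "f v = (case v of X \<Rightarrow> x | Y1 \<Rightarrow> y | Y2 \<Rightarrow> y' | Z \<Rightarrow> z)" for v
      define h where "h = \<lparr>iso_verts = f, iso_arcs = map_prod f f, iso_head = snd, iso_tail = fst\<rparr>"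
      have f: "f X = x" "f Y1 = y" "f Y2 = y'" "f Z = z" unfolding f_def by auto
      have "inj f"
      proof (rule injI)
        fix u v assume "f u = f v"
        then show "u = v" using dist f by (cases u; cases v) auto
      qed
      then have iso: "pre_digraph.digraph_isomorphism (with_proj diamond) h"
        unfolding pre_digraph.digraph_isomorphism_def h_def using oriented_digraph_diamond
        by (auto simp: oriented_digraph_def digraph_def fin_digraph_def inj_def inj_on_def)
      moreover have "subgraph (app_iso h (with_proj diamond)) (with_proj G)"
        unfolding subgraph_def compatible_def
        using arcs wf[OF arcs(1)] wf[OF arcs(4)] wf[OF arcs(3)] wf_digraph
        by (auto simp: h_def diamond_def f wf_digraph_def)
      ultimately show False using free unfolding contains_digraph_def digraph_iso_def by blast
    qed
  qed
qed

lemma contains_diamondE: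
  assumes "contains_digraph (with_proj G) (with_proj diamond)"
  obtains x y y' z where "y \<noteq> y'" "(x, y) \<in> parcs G" "(y, z) \<in> parcs G"
    "(x, y') \<in> parcs G" "(y', z) \<in> parcs G"
proof -
  from assms obtain h where iso: "pre_digraph.digraph_isomorphism (with_proj diamond) h"
    and sub: "subgraph (app_iso h (with_proj diamond)) (with_proj G)"
    unfolding contains_digraph_def digraph_iso_def by auto
  let ?f = "iso_verts h"
  have arc: "(?f u, ?f v) \<in> parcs G" if "(u, v) \<in> parcs diamond" for u v
  proof -
    \<comment> \<open>Compatibility forces \<open>fst\<close> and \<open>snd\<close> as tail and
      head of the copy, so an image arc is the pair of images of its ends.\<close>
    have "iso_arcs h (u, v) \<in> parcs G" "iso_tail h = fst" "iso_head h = snd"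
      using sub that unfolding subgraph_def compatible_def by auto
    moreover have "?f u = iso_tail h (iso_arcs h (u, v))" "?f v = iso_head h (iso_arcs h (u, v))"
      using iso that unfolding pre_digraph.digraph_isomorphism_def by auto
    ultimately show ?thesis by simp
  qed
  have "?f Y1 \<noteq> ?f Y2"
    using iso unfolding pre_digraph.digraph_isomorphism_def by (auto simp: diamond_def inj_on_def)
  then show ?thesis
    using that[of "?f Y1" "?f Y2" "?f X" "?f Z"] arc by (simp add: diamond_def)
qed

section \<open>The extremal construction\<close>

definition cyclic_blowup :: "nat \<Rightarrow> nat \<Rightarrow> nat pair_pre_digraph" where
  "cyclic_blowup h n = \<lparr> pverts = {..<n},
     parcs = {..<h} \<times> {h..<n} \<union> (\<lambda>a. (a, Suc a mod h)) ` {..<h} \<rparr>"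

text \<open>The lower bound on \<open>h\<close> keeps the cycle from being a loop or a pair of
  opposite arcs.\<close>

lemma oriented_cyclic_blowup:
  assumes "3 \<le> h" "h \<le> n"
  shows "oriented_digraph (with_proj (cyclic_blowup h n))"
proof -
  have mod: "Suc a mod h < h" for a using assms by simp
  have suc: "Suc a mod h = (if Suc a = h then 0 else Suc a)" if "a < h" for a
    using that by (auto simp: mod_Suc)
  have opp: "(v, u) \<notin> parcs (cyclic_blowup h n)" if "(u, v) \<in> parcs (cyclic_blowup h n)" for u v
    using that assms suc by (auto simp: cyclic_blowup_def split: if_splits)
  have verts: "u < n \<and> v < n" if "(u, v) \<in> parcs (cyclic_blowup h n)" for u v
    using that assms less_le_trans[OF mod[of u]] by (auto simp: cyclic_blowup_def)
  have fin: "finite (parcs (cyclic_blowup h n))" by (simp add: cyclic_blowup_def)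
  show ?thesis
  proof
    fix a assume a: "a \<in> arcs (with_proj (cyclic_blowup h n))"
    obtain u v where uv: "a = (u, v)" by force
    show "tail (with_proj (cyclic_blowup h n)) a \<in> verts (with_proj (cyclic_blowup h n))"
      "head (with_proj (cyclic_blowup h n)) a \<in> verts (with_proj (cyclic_blowup h n))"
      using verts[of u v] a uv by (auto simp: cyclic_blowup_def)
    show "tail (with_proj (cyclic_blowup h n)) a \<noteq> head (with_proj (cyclic_blowup h n)) a"
      using opp[of u v] a uv by auto
  next
    show "finite (verts (with_proj (cyclic_blowup h n)))" by (simp add: cyclic_blowup_def)
    show "finite (arcs (with_proj (cyclic_blowup h n)))" using fin by simp
  next
    fix a b assume "arc_to_ends (with_proj (cyclic_blowup h n)) a = arc_to_ends (with_proj (cyclic_blowup h n)) b"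
    then show "a = b" by (auto simp: arc_to_ends_def prod_eq_iff)
  next
    fix u v assume "(u, v) \<in> arcs_ends (with_proj (cyclic_blowup h n))"
    then show "(v, u) \<notin> arcs_ends (with_proj (cyclic_blowup h n))" using opp by simp
  qed
qed

text \<open>Vertices from h on have no out-arcs, so both middle vertices would lie on the cycle,
  where every vertex has only one successor.\<close>

lemma cyclic_blowup_no_diamond:
  "\<not> contains_digraph (with_proj (cyclic_blowup h n)) (with_proj diamond)"
proof
  assume "contains_digraph (with_proj (cyclic_blowup h n)) (with_proj diamond)"
  then show False by (rule contains_diamondE) (auto simp: cyclic_blowup_def)
qed

lemma card_cyclic_blowup:
  assumes "0 < h"
  shows "card (parcs (cyclic_blowup h n)) = h * (n - h) + h"
proof -
  have "card (parcs (cyclic_blowup h n)) =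
      card ({..<h} \<times> {h..<n}) + card ((\<lambda>a. (a, Suc a mod h)) ` {..<h})"
    unfolding cyclic_blowup_def pair_pre_digraph.simps
  proof (rule card_Un_disjoint)
    have "\<not> h \<le> Suc a mod h" for a using assms by (simp add: not_le)
    then show "{..<h} \<times> {h..<n} \<inter> (\<lambda>a. (a, Suc a mod h)) ` {..<h} = {}"
      by auto
  qed auto
  also have "card ((\<lambda>a. (a, Suc a mod h)) ` {..<h}) = h"
    by (subst card_image) (auto simp: inj_on_def)
  finally show ?thesis by (simp add: card_cartesian_product)
qed

section \<open>The extremal number\<close>

text \<open>The size of the construction and the claimed formula are both k^2 + k for n = 2 k and (k
  + 1)^2 for n = 2 k + 1.\<close>

lemma square_div_4_halves:
  fixes n :: nat
  shows "(n + 1) div 2 * (n - (n + 1) div 2) + (n + 1) div 2 = (n + 1)\<^sup>2 div 4"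
    and "\<lfloor>real n ^ 2 / 4\<rfloor> + \<lceil>real n / 2\<rceil> = int ((n + 1)\<^sup>2 div 4)"
proof -
  obtain k where "n = 2 * k \<or> n = 2 * k + 1" by (metis add.commute mod_mult_div_eq mult_0_right not_mod_2_eq_0_eq_1 oddE evenE)
  then have "((n + 1) div 2 * (n - (n + 1) div 2) + (n + 1) div 2 = (n + 1)\<^sup>2 div 4) \<and>
    \<lfloor>real n ^ 2 / 4\<rfloor> + \<lceil>real n / 2\<rceil> = int ((n + 1)\<^sup>2 div 4)"
  proof
    assume n: "n = 2 * k"
    have "(n + 1)\<^sup>2 = 4 * (k * k + k) + 1" unfolding n by (simp add: power2_eq_square algebra_simps)
    then have "(n + 1)\<^sup>2 div 4 = k * k + k" by simp
    moreover have "\<lfloor>real n ^ 2 / 4\<rfloor> = int (k * k)" "\<lceil>real n / 2\<rceil> = int k"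
      unfolding n by (auto simp: power2_eq_square floor_eq_iff ceiling_eq_iff)
    ultimately show ?thesis using n by simp
  next
    assume n: "n = 2 * k + 1"
    have "(n + 1)\<^sup>2 = 4 * (k * k + 2 * k + 1)" unfolding n by (simp add: power2_eq_square algebra_simps)
    then have "(n + 1)\<^sup>2 div 4 = k * k + 2 * k + 1" by simp
    moreover have "\<lfloor>real n ^ 2 / 4\<rfloor> = int (k * k + k)" "\<lceil>real n / 2\<rceil> = int k + 1"
      unfolding n by (auto simp: power2_eq_square floor_eq_iff ceiling_eq_iff field_simps)
    ultimately show ?thesis using n by simp
  qed
  then show "(n + 1) div 2 * (n - (n + 1) div 2) + (n + 1) div 2 = (n + 1)\<^sup>2 div 4"
    and "\<lfloor>real n ^ 2 / 4\<rfloor> + \<lceil>real n / 2\<rceil> = int ((n + 1)\<^sup>2 div 4)" by auto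
qed

lemma ex_ori_diamond:
  assumes n: "10 ^ 13 \<le> n"
  shows "ex_ori n (with_proj diamond) = (n + 1)\<^sup>2 div 4"
  unfolding ex_ori_def
proof (rule Max_eqI)
  show "finite (free_arc_counts n (with_proj diamond))" by (rule finite_free_arc_counts)
  fix m assume "m \<in> free_arc_counts n (with_proj diamond)"
  then obtain G :: "nat pair_pre_digraph" where m: "m = card (parcs G)"
    and "oriented_digraph (with_proj G)" "\<not> contains_digraph (with_proj G) (with_proj diamond)"
    and card: "card (pverts G) = n"
    unfolding free_arc_counts_def by auto
  then interpret diamond_free "pverts G" "parcs G" using diamond_free_if_not_contains by blast
  show "m \<le> (n + 1)\<^sup>2 div 4" using card_R_le n card m by simp
next
  let ?h = "(n + 1) div 2"
  have h: "3 \<le> ?h" "?h \<le> n" using n by auto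
  have "card (parcs (cyclic_blowup ?h n)) = (n + 1)\<^sup>2 div 4"
    using card_cyclic_blowup[of ?h n] h square_div_4_halves(1)[of n] by linarith
  moreover have "card (pverts (cyclic_blowup ?h n)) = n" by (simp add: cyclic_blowup_def)
  ultimately show "(n + 1)\<^sup>2 div 4 \<in> free_arc_counts n (with_proj diamond)"
    unfolding free_arc_counts_def
    using oriented_cyclic_blowup[OF h] cyclic_blowup_no_diamond
    by (intro CollectI exI[of _ "cyclic_blowup ?h n"]) simp
qed

theorem theorem3p2:
  shows "\<forall>\<^sub>F n in sequentially.
    int (ex_ori n (with_proj diamond)) = \<lfloor>real n ^ 2 / 4\<rfloor> + \<lceil>real n / 2\<rceil>"
  using eventually_ge_at_top[of "10 ^ 13 :: nat"]
  by eventually_elim (simp only: ex_ori_diamond square_div_4_halves(2))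

end
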